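(* Let $\Sigma=(A,B,C_1,C_2,D,E,F,\varphi)$ and $\hat\Sigma=(\hat A,\hat B,\hat C_1,\hat C_2,\hat D,\hat E,\hat F,\varphi)$ be two control systems of the slope-restricted class described in the context (same $\varphi$, with slope bounds $0$ and $b\in\mathbb{R}_{>0}\cup\{\infty\}$), with state dimensions $n,\hat n$, external input dimensions $m,\hat m$, internal input dimensions $p,\hat p$, internal output dimensions $q_2,\hat q_2$, and equal external output dimensions $q_1=\hat q_1$. Suppose that for some constant $\hat\kappa>0$ there exist matrices $\widehat M\succ0$ ($n\times n$), $K$ ($m\times n$), $L_1$ ($m\times1$), $Z$ ($n\times r$), $W$ ($r\times p$), and $X^{11}$ ($r\times r$), $X^{12}$ ($r\times q_2$), $X^{21}$ ($q_2\times r$), $X^{22}\preceq0$ ($q_2\times q_2$), the latter four being the blocks of a symmetric matrix, such that $D=ZW$ and $$\begin{bmatrix} (A+BK)^T\widehat M+\widehat M(A+BK) & \widehat MZ & \widehat M(BL_1+E) \\ Z^T\widehat M & 0 & 0 \\ (BL_1+E)^T\widehat M & 0 & 0 \end{bmatrix}\preceq\begin{bmatrix} -\hat\kappa\widehat M+C_2^TX^{22}C_2 & C_2^TX^{21} & -F^T \\ X^{12}C_2 & X^{11} & 0 \\ -F & 0 & \frac{2}{b} \end{bmatrix}$$ (with $2/b=0$ if $b=\infty$). Suppose moreover that there exist matrices $P$ ($n\times\hat n$), $Q$ ($m\times\hat n$), $H$ ($q_2\times\hat q_2$), $L_2$ ($m\times1$) and $\hat W$ ($r\times\hat p$) such that $$AP=P\hat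 A-BQ,\quad C_1P=\hat C_1,\quad X^{12}C_2P=X^{12}H\hat C_2,\quad X^{22}C_2P=X^{22}H\hat C_2,$$ $$FP=\hat F,\quad E=P\hat E-B(L_1-L_2),\quad P\hat D=Z\hat W.$$ Then the function $$V(x,\hat x)=(x-P\hat x)^T\widehat M(x-P\hat x),\qquad x\in\mathbb{R}^n,\ \hat x\in\mathbb{R}^{\hat n},$$ is a storage function from $\hat\Sigma$ to $\Sigma$.
   Context: Class of systems: $\Sigma=(A,B,C_1,C_2,D,E,F,\varphi)$ denotes the control system $$\dot\xi=A\xi+E\varphi(F\xi)+B\upsilon+D\omega,\qquad \zeta_1=C_1\xi,\qquad \zeta_2=C_2\xi,$$ with state $\xi\in\mathbb{R}^n$, external input $\upsilon\in\mathbb{R}^m$, internal input $\omega\in\mathbb{R}^p$, external output $\zeta_1\in\mathbb{R}^{q_1}$, internal output $\zeta_2\in\mathbb{R}^{q_2}$, and $A\in\mathbb{R}^{n\times n}$, $E\in\mathbb{R}^{n\times1}$, $F\in\mathbb{R}^{1\times n}$, $B\in\mathbb{R}^{n\times m}$, $D\in\mathbb{R}^{n\times p}$, $C_1\in\mathbb{R}^{q_1\times n}$, $C_2\in\mathbb{R}^{q_2\times n}$. The function $\varphi:\mathbb{R}\to\mathbb{R}$ satisfies $0\le\frac{\varphi(v)-\varphi(w)}{v-w}\le b$ for all $v\ne w$ in $\mathbb{R}$, for some $b\in\mathbb{R}_{>0}\cup\{\infty\}$ (if $b=\infty$ there is no upper bound). By convention $\varphi$ is nonlinear and $E$ is nonzero.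 In the general notation below, $f(x,u,w)=Ax+E\varphi(Fx)+Bu+Dw$, $h_1(x)=C_1x$, $h_2(x)=C_2x$; $f$ is continuous and Lipschitz in $x$ on compact sets, uniformly in $(u,w)$. The same applies to $\hat\Sigma$, with dimensions $\hat n,\hat m,\hat p,\hat q_1,\hat q_2$. A function $\gamma:\mathbb{R}_{\ge0}\to\mathbb{R}_{\ge0}$ is of class $\mathcal{K}_\infty$ if it is continuous, strictly increasing, $\gamma(0)=0$ and $\gamma(r)\to\infty$ as $r\to\infty$; $0$ in $\mathcal{K}_\infty\cup\{0\}$ is the zero function. $\|\cdot\|$ is the Euclidean norm; $\preceq$, $\succ$ refer to the semidefinite order on symmetric matrices. Storage function: for control systems with dynamics $f,\hat f$, external output maps $h_1,\hat h_1$ (with values in the same space) and internal output maps $h_2,\hat h_2$, a continuously differentiable $V:\mathbb{R}^n\times\mathbb{R}^{\hat n}\to\mathbb{R}_{\ge0}$ is a storage function from $\hat\Sigma$ to $\Sigma$ if there exist $\alpha,\eta\in\mathcal{K}_\infty$, $\rho_{\mathrm{ext}}\in\mathcal{K}_\infty\cup\{0\}$, matrices $W,\hat W,H$ of appropriate dimensions, and a symmetric matrix $X=\begin{bmatrix} X^{11} & X^{12} \\ X^{21} & X^{22} \end{bmatrix}$ (conformally partitioned) with $X^{22}\preceq0$, such that for all $x\in\mathbb{R}^n$, $\hat x\in\mathbb{R}^{\hat n}$: $\alpha(\|h_1(x)-\hat h_1(\hat x)\|)\le V(x,\hat x)$, and for every $\hat u\in\mathbb{R}^{\hat m}$ there is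 $u\in\mathbb{R}^m$ such that for all $\hat w\in\mathbb{R}^{\hat p}$, $w\in\mathbb{R}^p$, $$\nabla V(x,\hat x)^T\begin{bmatrix}f(x,u,w)\\ \hat f(\hat x,\hat u,\hat w)\end{bmatrix}\le-\eta(V(x,\hat x))+\rho_{\mathrm{ext}}(\|\hat u\|)+\begin{bmatrix}Ww-\hat W\hat w\\ h_2(x)-H\hat h_2(\hat x)\end{bmatrix}^TX\begin{bmatrix}Ww-\hat W\hat w\\ h_2(x)-H\hat h_2(\hat x)\end{bmatrix}.$$ *)

theory Defs
  imports "HOL-Analysis.Analysis"
begin

definition hcat :: "real^'c^'a \<Rightarrow> real^'d^'a \<Rightarrow> real^('c + 'd)^'a"  (infixr "<|>" 60)
  where "M <|> N = (\<chi> i j. case j of Inl k \<Rightarrow> M $ i $ k | Inr k \<Rightarrow> N $ i $ k)"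

definition vcat :: "real^'c^'a \<Rightarrow> real^'c^'b \<Rightarrow> real^'c^('a + 'b)"  (infixr "<'/>" 55)
  where "M </> N = (\<chi> i. case i of Inl k \<Rightarrow> M $ k | Inr k \<Rightarrow> N $ k)"

definition symmetric_matrix :: "real^'a^'a \<Rightarrow> bool"
  where "symmetric_matrix M \<longleftrightarrow> transpose M = M"

definition loewner_le :: "real^'a^'a \<Rightarrow> real^'a^'a \<Rightarrow> bool"  (infix "\<preceq>" 50)
  where "M \<preceq> N \<longleftrightarrow> symmetric_matrix M \<and> symmetric_matrix N
    \<and> (\<forall>v. v \<bullet> (M *v v) \<le> v \<bullet> (N *v v))"

definition pos_definite :: "real^'a^'a \<Rightarrow> bool"
  where "pos_definite M \<longleftrightarrow> symmetric_matrix M \<and> (\<forall>v. v \<noteq> 0 \<longrightarrow> 0 < v \<bullet> (M *v v))"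

(* Comparison functions live on [0, infinity); their values at negative reals are irrelevant. *)
definition class_K_inf :: "(real \<Rightarrow> real) \<Rightarrow> bool"
  where "class_K_inf g \<longleftrightarrow> continuous_on {0..} g \<and> strict_mono_on {0..} g \<and> g 0 = 0
    \<and> filterlim g at_top at_top"

(* The bound b ranges over the positive extended reals, b = \<infinity> meaning no upper bound. *)
definition slope_restricted :: "ereal \<Rightarrow> (real \<Rightarrow> real) \<Rightarrow> bool"
  where "slope_restricted b \<phi> \<longleftrightarrow> (\<forall>v w. v \<noteq> w \<longrightarrow>
    0 \<le> (\<phi> v - \<phi> w) / (v - w) \<and> ereal ((\<phi> v - \<phi> w) / (v - w)) \<le> b)"

definition vector_field ::
  "real^'n^'n \<Rightarrow> real^'m^'n \<Rightarrow> real^'p^'n \<Rightarrow> real^1^'n \<Rightarrow> real^'n^1 \<Rightarrow> (real \<Rightarrow> real)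
    \<Rightarrow> real^'n \<Rightarrow> real^'m \<Rightarrow> real^'p \<Rightarrow> real^'n"
  where "vector_field A B D E F \<phi> x u w =
    A *v x + E *v (\<chi> _. \<phi> ((F *v x) $ 1)) + B *v u + D *v w"

definition regular_field :: "(real^'n \<Rightarrow> real^'m \<Rightarrow> real^'p \<Rightarrow> real^'n) \<Rightarrow> bool"
  where "regular_field f \<longleftrightarrow>
    continuous_on UNIV (\<lambda>(x, u, w). f x u w)
    \<and> (\<forall>S. compact S \<longrightarrow> (\<exists>L. \<forall>u w. L-lipschitz_on S (\<lambda>x. f x u w)))"

(* The output matrices C1 and C2 are unconstrained, so they do not occur here. *)
definition slope_restricted_system ::
  "ereal \<Rightarrow> real^'n^'n \<Rightarrow> real^'m^'n \<Rightarrow> real^'p^'n \<Rightarrow> real^1^'n \<Rightarrow> real^'n^1 \<Rightarrow> (real \<Rightarrow> real) \<Rightarrow> bool"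
  where "slope_restricted_system b A B D E F \<phi> \<longleftrightarrow>
    0 < b \<and> slope_restricted b \<phi> \<and> \<not> linear \<phi> \<and> E \<noteq> 0
    \<and> regular_field (vector_field A B D E F \<phi>)"

(* The number r of rows of W and W' (the matrix called W-hat) is existentially quantified, hence a
   natural number rather than a type: W i and W' i are the i-th rows for i < r, and X is indexed
   by {..<r} <+> UNIV, the block X^{22} being the one on the Inr indices. *)
definition supply_vector ::
  "(nat \<Rightarrow> real^'p) \<Rightarrow> (nat \<Rightarrow> real^'ph) \<Rightarrow> real^'p \<Rightarrow> real^'ph \<Rightarrow> real^'q2 \<Rightarrow> nat + 'q2 \<Rightarrow> real"
  where "supply_vector W W' w w' y = (\<lambda>a. case a of Inl i \<Rightarrow> W i \<bullet> w - W' i \<bullet> w' | Inr j \<Rightarrow> y $ j)"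

definition quad_form :: "'a set \<Rightarrow> ('a \<Rightarrow> 'a \<Rightarrow> real) \<Rightarrow> ('a \<Rightarrow> real) \<Rightarrow> real"
  where "quad_form I X z = (\<Sum>a\<in>I. \<Sum>b\<in>I. z a * X a b * z b)"

(* V is a storage function from the system (f', h1', h2') to the system (f, h1, h2). *)
definition storage_function ::
  "(real^'nh \<Rightarrow> real^'mh \<Rightarrow> real^'ph \<Rightarrow> real^'nh) \<Rightarrow> (real^'nh \<Rightarrow> real^'q1) \<Rightarrow> (real^'nh \<Rightarrow> real^'q2h)
    \<Rightarrow> (real^'n \<Rightarrow> real^'m \<Rightarrow> real^'p \<Rightarrow> real^'n) \<Rightarrow> (real^'n \<Rightarrow> real^'q1) \<Rightarrow> (real^'n \<Rightarrow> real^'q2)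
    \<Rightarrow> ((real^'n) \<times> (real^'nh) \<Rightarrow> real) \<Rightarrow> bool"
  where "storage_function f' h1' h2' f h1 h2 V \<longleftrightarrow>
    (\<forall>z. 0 \<le> V z) \<and>
    (\<exists>gradV. (\<forall>z. GDERIV V z :> gradV z) \<and> continuous_on UNIV gradV \<and>
      (\<exists>\<alpha> \<eta> \<rho> (r::nat) (W :: nat \<Rightarrow> real^'p) (W' :: nat \<Rightarrow> real^'ph) (H :: real^'q2h^'q2)
          (X :: nat + 'q2 \<Rightarrow> nat + 'q2 \<Rightarrow> real).
        class_K_inf \<alpha> \<and> class_K_inf \<eta> \<and> (class_K_inf \<rho> \<or> \<rho> = (\<lambda>_. 0)) \<and> 0 < r \<and>
        (\<forall>a \<in> {..<r} <+> UNIV. \<forall>b \<in> {..<r} <+> UNIV. X a b = X b a) \<and>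
        (\<chi> i j. X (Inr i) (Inr j)) \<preceq> 0 \<and>
        (\<forall>x x'. \<alpha> (norm (h1 x - h1' x')) \<le> V (x, x') \<and>
          (\<forall>u'. \<exists>u. \<forall>w' w.
            gradV (x, x') \<bullet> (f x u w, f' x' u' w')
              \<le> - \<eta> (V (x, x')) + \<rho> (norm u')
                + quad_form ({..<r} <+> UNIV) X (supply_vector W W' w w' (h2 x - H *v h2' x'))))))"

end

theory Submission
  imports Defs
begin

text \<open>
  With the error \<open>e = x - P x'\<close> and the interface
  \<open>u = K e + Q x' + L1 \<phi>(F x) - L2 \<phi>(F P x')\<close>, the matrix identities turn the error dynamics into
  \<open>e' = (A + B K) e + Z (W w - Wh w') + (B L1 + E) d - P Bh u'\<close> with \<open>d = \<phi>(F x) - \<phi>(F P x')\<close>.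
  Evaluating the matrix inequality at \<open>(e, W w - Wh w', d)\<close> bounds the derivative of \<open>V\<close> up to the
  term in \<open>u'\<close>; the slope restriction says \<open>d (d / b - F e) \<le> 0\<close>, which removes the entries involving
  \<open>d\<close>. The term in \<open>u'\<close> is split by Young's inequality at the price of half of the decay rate.
\<close>

section \<open>Block matrices\<close>

text \<open>Stacking of vectors to match \<open><|>\<close> and \<open></>\<close>: block matrices
  act on a \<open>vjoin\<close> block by block, so no computation below has to sum over a sum type
  again.\<close>

definition vjoin :: "'c^'a \<Rightarrow> 'c^'b \<Rightarrow> 'c^('a + 'b)"
  where "vjoin x y = (\<chi> i. case i of Inl k \<Rightarrow> x $ k | Inr k \<Rightarrow> y $ k)"

lemma sum_UNIV_Plus:
  fixes f :: "'a::finite + 'b::finite \<Rightarrow> 'c::comm_monoid_add"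
  shows "sum f UNIV = (\<Sum>i\<in>UNIV. f (Inl i)) + (\<Sum>j\<in>UNIV. f (Inr j))"
  by (simp add: UNIV_Plus_UNIV [symmetric] sum.Plus del: UNIV_Plus_UNIV)

lemma inner_vjoin: "vjoin x y \<bullet> vjoin x' y' = x \<bullet> x' + y \<bullet> y'"
  by (simp add: inner_vec_def sum_UNIV_Plus vjoin_def)

lemma hcat_mult_vjoin: "(M <|> N) *v vjoin x y = M *v x + N *v y"
  by (simp add: vec_eq_iff matrix_vector_mult_def hcat_def vjoin_def sum_UNIV_Plus)

lemma vcat_mult: "(M </> N) *v z = vjoin (M *v z) (N *v z)"
  by (auto simp: vec_eq_iff matrix_vector_mult_def vcat_def vjoin_def split: sum.split)

lemma symmetric_matrix_nth:
  assumes "symmetric_matrix M"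
  shows "M $ i $ j = M $ j $ i"
proof -
  have "transpose M $ i $ j = M $ i $ j"
    using assms by (simp add: symmetric_matrix_def)
  then show ?thesis
    by (simp add: transpose_def)
qed

lemma symmetric_blockD:
  assumes "symmetric_matrix ((X11 <|> X12) </> (X21 <|> X22))"
  shows "transpose X12 = X21"
proof -
  have "X12 $ i $ j = X21 $ j $ i" for i j
    using symmetric_matrix_nth [OF assms, of "Inl i" "Inr j"] by (simp add: hcat_def vcat_def)
  then show ?thesis
    by (simp add: vec_eq_iff transpose_def)
qed

text \<open>Moves a transpose to the other side of the inner product. Later calls that use it delete
  \<open>transpose_matrix_vector\<close>, a simp rule that would turn
  \<open>transpose M *v y\<close> into \<open>y v* M\<close> first.\<close>

lemma inner_transpose_matrix: "x \<bullet> (transpose M *v y) = y \<bullet> (M *v x)" for M :: "real^'n^'m"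
  by (simp add: inner_commute [of x] dot_lmul_matrix)

lemma symmetric_matrix_inner:
  assumes "symmetric_matrix M"
  shows "x \<bullet> (M *v y) = y \<bullet> (M *v x)"
  using inner_transpose_matrix [of x M y] unfolding assms [unfolded symmetric_matrix_def] .

lemma minus_matrix_vector: "(- M) *v x = - (M *v x)" for M :: "real^'n^'m"
  by (simp add: vec_eq_iff matrix_vector_mult_def sum_negf)

lemma scaleR_matrix_vector: "(c *\<^sub>R M) *v x = c *\<^sub>R (M *v x)" for M :: "real^'n^'m"
  by (simp add: vec_eq_iff matrix_vector_mult_def sum_distrib_left mult.assoc)

text \<open>Bridge between the two encodings of the supply rate: \<open>storage_function\<close>
  sums over an index set containing naturals, the matrix inequality lives on finite types.\<close>

lemma quad_form_reindex:
  fixes Y :: "real^'n^'n"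
  assumes "bij_betw g I UNIV"
  shows "quad_form I (\<lambda>a b. Y $ g a $ g b) (\<lambda>a. v $ g a) = v \<bullet> (Y *v v)"
proof -
  have "quad_form I (\<lambda>a b. Y $ g a $ g b) (\<lambda>a. v $ g a) = (\<Sum>i\<in>UNIV. \<Sum>j\<in>UNIV. v $ i * Y $ i $ j * v $ j)"
    unfolding quad_form_def
    by (subst sum.reindex_bij_betw [OF assms, symmetric],
        subst sum.reindex_bij_betw [OF assms, symmetric]) simp
  also have "\<dots> = v \<bullet> (Y *v v)"
    by (simp add: inner_vec_def matrix_vector_mult_def sum_distrib_left mult.assoc)
  finally show ?thesis .
qed

lemma bij_betw_map_sum_id:
  assumes "bij_betw f S UNIV"
  shows "bij_betw (map_sum f id) (S <+> UNIV) UNIV"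
proof (rule bij_betwI')
  fix x y assume "x \<in> S <+> (UNIV :: 'c set)" "y \<in> S <+> (UNIV :: 'c set)"
  then show "map_sum f id x = map_sum f id y \<longleftrightarrow> x = y"
    using assms by (auto simp: bij_betw_def inj_on_def)
next
  fix y
  show "\<exists>x\<in>S <+> UNIV. y = map_sum f id x"
  proof (cases y)
    case (Inl a)
    then obtain i where "i \<in> S" "a = f i"
      using assms by (auto simp: bij_betw_def)
    then show ?thesis using Inl by (intro bexI [of _ "Inl i"]) auto
  qed force
qed simp

section \<open>Quadratic forms\<close>

lemma pos_definite_nonneg:
  assumes "pos_definite M"
  shows "0 \<le> v \<bullet> (M *v v)"
  using assms by (cases "v = 0") (auto simp: pos_definite_def less_imp_le)

text \<open>The constant is the minimum of the form on the unit sphere, attained by compactness and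
  positive by definiteness; homogeneity of degree two extends the bound to all
  \<open>v\<close>.\<close>

lemma pos_definite_coercive:
  fixes M :: "real^'n^'n"
  assumes "pos_definite M"
  obtains c where "0 < c" "\<And>v. c * (norm v)\<^sup>2 \<le> v \<bullet> (M *v v)"
proof -
  let ?S = "sphere (0 :: real^'n) 1"
  have "continuous_on ?S (\<lambda>v. v \<bullet> (M *v v))"
    by (intro continuous_intros linear_continuous_on) (simp add: matrix_vector_mul_bounded_linear)
  moreover have "?S \<noteq> {}"
    by simp
  ultimately obtain s where s: "s \<in> ?S" "\<And>v. v \<in> ?S \<Longrightarrow> s \<bullet> (M *v s) \<le> v \<bullet> (M *v v)"
    using continuous_attains_inf [of ?S "\<lambda>v. v \<bullet> (M *v v)"] by (metis compact_sphere)
  show thesis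
  proof
    show "0 < s \<bullet> (M *v s)"
      using assms s(1) by (cases "s = 0") (auto simp: pos_definite_def)
    show "s \<bullet> (M *v s) * (norm v)\<^sup>2 \<le> v \<bullet> (M *v v)" for v
    proof (cases "v = 0")
      case False
      let ?w = "(1 / norm v) *\<^sub>R v"
      have "?w \<in> ?S"
        using False by simp
      then have "s \<bullet> (M *v s) \<le> ?w \<bullet> (M *v ?w)"
        by (rule s)
      also have "\<dots> = (v \<bullet> (M *v v)) / (norm v)\<^sup>2"
        by (simp add: matrix_vector_mult_scaleR power2_eq_square)
      finally show ?thesis
        using False by (simp add: field_simps)
    qed simp
  qed
qed

text \<open>Cauchy-Schwarz with operator bounds for \<open>N\<close> and \<open>M\<close>. The
  constant is positive even if \<open>N\<close> or \<open>M\<close> is zero, so that it can later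
  serve as a coefficient of a class \<open>class_K_inf\<close> function.\<close>

lemma quadratic_form_upper_bound:
  fixes M :: "real^'n^'n" and N :: "real^'m^'n"
  obtains c where "0 < c" "\<And>u. (N *v u) \<bullet> (M *v (N *v u)) \<le> c * (norm u)\<^sup>2"
proof -
  obtain k where k: "0 < k" "\<And>u. norm (N *v u) \<le> norm u * k"
    using bounded_linear.pos_bounded [OF matrix_vector_mul_bounded_linear] by blast
  obtain l where l: "0 < l" "\<And>u. norm (M *v u) \<le> norm u * l"
    using bounded_linear.pos_bounded [OF matrix_vector_mul_bounded_linear] by blast
  show thesis
  proof
    show "0 < k * k * l"
      using k l by simp
    fix u
    have "(N *v u) \<bullet> (M *v (N *v u)) \<le> norm (N *v u) * norm (M *v (N *v u))"
      by (rule norm_cauchy_schwarz)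
    also have "\<dots> \<le> norm (N *v u) * (norm (N *v u) * l)"
      by (intro mult_left_mono l) simp
    also have "\<dots> \<le> (norm u * k) * ((norm u * k) * l)"
      using k l by (intro mult_mono) auto
    finally show "(N *v u) \<bullet> (M *v (N *v u)) \<le> k * k * l * (norm u)\<^sup>2"
      by (simp add: power2_eq_square mult_ac)
  qed
qed

lemma pos_definite_young:
  fixes M :: "real^'n^'n"
  assumes "pos_definite M" "0 < \<kappa>"
  shows "- 2 * (e \<bullet> (M *v g)) \<le> \<kappa> / 2 * (e \<bullet> (M *v e)) + 2 / \<kappa> * (g \<bullet> (M *v g))"
proof -
  \<comment> \<open>The claim is nonnegativity of the form at this vector, multiplied by
    \<open>2 / \<kappa>\<close>. The weight \<open>\<kappa> / 2\<close> makes the \<open>e\<close>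
    term cost exactly half of the decay rate.\<close>
  let ?v = "(\<kappa> / 2) *\<^sub>R e + g"
  have "0 \<le> ?v \<bullet> (M *v ?v)"
    by (rule pos_definite_nonneg [OF assms(1)])
  also have "\<dots> = \<kappa>\<^sup>2 / 4 * (e \<bullet> (M *v e)) + \<kappa> * (e \<bullet> (M *v g)) + g \<bullet> (M *v g)"
    using symmetric_matrix_inner [of M g e] assms(1)
    by (simp add: pos_definite_def matrix_vector_mult_scaleR matrix_vector_right_distrib
        inner_add_left inner_add_right power2_eq_square algebra_simps)
  finally have "0 \<le> 2 / \<kappa> * (\<kappa>\<^sup>2 / 4 * (e \<bullet> (M *v e)) + \<kappa> * (e \<bullet> (M *v g)) + g \<bullet> (M *v g))"
    using assms(2) by (intro mult_nonneg_nonneg) auto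
  then show ?thesis
    using assms(2) by (simp add: algebra_simps power2_eq_square)
qed

text \<open>Product rule for the linear map \<open>(x, x') \<mapsto> x - P *v x'\<close>: symmetry
  of \<open>M\<close> merges its two terms into one with factor 2, and the adjoint of that map gives
  the second component \<open>- (transpose P *v g)\<close>.\<close>

lemma GDERIV_quadratic_error:
  fixes M :: "real^'n^'n" and P :: "real^'k^'n"
  assumes "symmetric_matrix M"
  shows "GDERIV (\<lambda>(x, x'). (x - P *v x') \<bullet> (M *v (x - P *v x'))) z :>
    (let g = 2 *\<^sub>R (M *v (fst z - P *v snd z)) in (g, - (transpose P *v g)))"
proof -
  let ?e = "\<lambda>z :: (real^'n) \<times> (real^'k). fst z - P *v snd z"
  have e: "(?e has_derivative ?e) (at z)"
    by (intro bounded_linear_imp_has_derivative bounded_linear_sub bounded_linear_fst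
        bounded_linear_compose [OF matrix_vector_mul_bounded_linear bounded_linear_snd])
  then have "((\<lambda>z. M *v ?e z) has_derivative (\<lambda>h. M *v ?e h)) (at z)"
    by (rule bounded_linear.has_derivative [OF matrix_vector_mul_bounded_linear])
  with e have "((\<lambda>z. ?e z \<bullet> (M *v ?e z)) has_derivative
      (\<lambda>h. ?e z \<bullet> (M *v ?e h) + ?e h \<bullet> (M *v ?e z))) (at z)"
    by (rule has_derivative_inner)
  moreover have "?e z \<bullet> (M *v ?e h) + ?e h \<bullet> (M *v ?e z) =
      h \<bullet> (let g = 2 *\<^sub>R (M *v ?e z) in (g, - (transpose P *v g)))" for h
    using symmetric_matrix_inner [OF assms, of "?e z" "?e h"]
    by (cases h) (simp add: Let_def inner_Pair inner_transpose_matrix inner_commute inner_diff_left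
        del: transpose_matrix_vector)
  ultimately show ?thesis
    by (simp add: gderiv_def case_prod_unfold)
qed

section \<open>Comparison functions\<close>

lemma class_K_inf_linear:
  assumes "0 < c"
  shows "class_K_inf (\<lambda>t. c * t)"
  unfolding class_K_inf_def
proof (intro conjI)
  show "filterlim (\<lambda>t. c * t) at_top at_top"
    using assms by (intro filterlim_tendsto_pos_mult_at_top [OF tendsto_const]) (auto simp: filterlim_ident)
qed (use assms in \<open>auto intro!: continuous_intros simp: strict_mono_on_def\<close>)

lemma class_K_inf_square:
  assumes "0 < c"
  shows "class_K_inf (\<lambda>t. c * t\<^sup>2)"
  unfolding class_K_inf_def
proof (intro conjI)
  show "filterlim (\<lambda>t. c * t\<^sup>2) at_top at_top"
    using assms
    by (intro filterlim_tendsto_pos_mult_at_top [OF tendsto_const] filterlim_pow_at_top filterlim_ident)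
       auto
  show "strict_mono_on {0..} (\<lambda>t. c * t\<^sup>2)"
    using assms by (auto simp: strict_mono_on_def intro!: power_strict_mono)
qed (auto intro!: continuous_intros)

section \<open>The dissipation inequality\<close>

text \<open>With \<open>s\<close> the difference quotient, \<open>s \<le> b\<close> gives
  \<open>2 / b * s \<le> 2\<close>; multiplying by \<open>s * (v - w)\<^sup>2\<close>, nonnegative
  because \<open>0 \<le> s\<close>, gives the claim.\<close>

lemma slope_restricted_sector:
  assumes "slope_restricted b \<phi>" "0 < b"
  shows "real_of_ereal (2 / b) * (\<phi> v - \<phi> w)\<^sup>2 \<le> 2 * ((\<phi> v - \<phi> w) * (v - w))"
proof (cases "v = w")
  case False
  define s where "s = (\<phi> v - \<phi> w) / (v - w)"
  have s: "0 \<le> s" "ereal s \<le> b"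
    using assms False by (auto simp: slope_restricted_def s_def)
  have d: "\<phi> v - \<phi> w = s * (v - w)"
    using False by (simp add: s_def)
  have "real_of_ereal (2 / b) * s \<le> 2"
  \<comment> \<open>For \<open>b = \<infinity>\<close> the quotient \<open>2 / b\<close> is 0 and
    the bound is trivial; \<open>b = -\<infinity>\<close> contradicts \<open>0 < b\<close>.\<close>
  proof (cases b)
    case (real r)
    moreover have "2 / ereal r = ereal (2 / r)"
      using real assms(2) by (metis divide_ereal_def ereal_divide numeral_eq_ereal ereal_less(2) less_irrefl)
    ultimately show ?thesis
      using s assms(2) by (simp add: field_simps)
  qed (use s assms in auto)
  then have "real_of_ereal (2 / b) * s * (s * (v - w)\<^sup>2) \<le> 2 * (s * (v - w)\<^sup>2)"
    by (rule mult_right_mono) (use s in simp)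
  then show ?thesis
    unfolding d by (simp add: power2_eq_square algebra_simps)
qed simp

text \<open>Tests the matrix inequality on the stacked vector of \<open>e\<close>,
  \<open>\<omega>\<close> and \<open>d\<close>. Mirrored off-diagonal blocks contribute equally, by
  symmetry of \<open>M\<close> on the left and by \<open>transpose X12 = X21\<close> on the right,
  hence the factors 2.\<close>

lemma loewner_block_dissipation:
  fixes M G :: "real^'n^'n" and Z :: "real^'r^'n" and N :: "real^1^'n"
    and C :: "real^'n^'q" and F :: "real^'n^1"
  assumes "symmetric_matrix M" "transpose X12 = X21"
    and "(  transpose G ** M + M ** G <|> M ** Z <|> M ** N
        </> transpose Z ** M <|> 0 <|> 0
        </> transpose N ** M <|> 0 <|> 0)
       \<preceq>
         (  - (\<kappa> *\<^sub>R M) + transpose C ** X22 ** C <|> transpose C ** X21 <|> - transpose F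
        </> X12 ** C <|> X11 <|> 0
        </> - F <|> 0 <|> mat \<beta>)"
  shows "2 * (e \<bullet> (M *v (G *v e + Z *v \<omega> + N *v d)))
    \<le> - \<kappa> * (e \<bullet> (M *v e)) + (C *v e) \<bullet> (X22 *v (C *v e)) + 2 * (\<omega> \<bullet> (X12 *v (C *v e)))
      + \<omega> \<bullet> (X11 *v \<omega>) - 2 * (d \<bullet> (F *v e)) + \<beta> * (d \<bullet> d)"
proof -
  let ?v = "vjoin e (vjoin \<omega> d)"
  have sym: "x \<bullet> (M *v y) = y \<bullet> (M *v x)" for x y
    by (rule symmetric_matrix_inner [OF assms(1)])
  have mat: "mat \<beta> *v d = \<beta> *\<^sub>R d"
    by (simp add: vec_eq_iff mat_def matrix_vector_mult_def if_distrib cong: if_cong)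
  have lhs: "?v \<bullet> ((  transpose G ** M + M ** G <|> M ** Z <|> M ** N
        </> transpose Z ** M <|> 0 <|> 0
        </> transpose N ** M <|> 0 <|> 0) *v ?v) = 2 * (e \<bullet> (M *v (G *v e + Z *v \<omega> + N *v d)))"
    using sym [of "G *v e" e] sym [of "Z *v \<omega>" e] sym [of "N *v d" e]
    by (simp add: vcat_mult hcat_mult_vjoin inner_vjoin matrix_vector_mul_assoc [symmetric]
        matrix_vector_mult_add_rdistrib inner_add_right inner_transpose_matrix
        matrix_vector_right_distrib inner_commute del: transpose_matrix_vector)
  have x21: "e \<bullet> (transpose C *v (X21 *v \<omega>)) = \<omega> \<bullet> (X12 *v (C *v e))"
    using assms(2) inner_transpose_matrix [of "C *v e" X12 \<omega>]
    by (simp add: inner_transpose_matrix inner_commute del: transpose_matrix_vector)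
  have rhs: "?v \<bullet> ((  - (\<kappa> *\<^sub>R M) + transpose C ** X22 ** C <|> transpose C ** X21 <|> - transpose F
        </> X12 ** C <|> X11 <|> 0
        </> - F <|> 0 <|> mat \<beta>) *v ?v)
      = - \<kappa> * (e \<bullet> (M *v e)) + (C *v e) \<bullet> (X22 *v (C *v e)) + 2 * (\<omega> \<bullet> (X12 *v (C *v e)))
      + \<omega> \<bullet> (X11 *v \<omega>) - 2 * (d \<bullet> (F *v e)) + \<beta> * (d \<bullet> d)"
    using x21
    by (simp add: vcat_mult hcat_mult_vjoin inner_vjoin matrix_vector_mul_assoc [symmetric]
        matrix_vector_mult_add_rdistrib inner_add_right inner_transpose_matrix
        minus_matrix_vector scaleR_matrix_vector mat inner_commute
        matrix_vector_mult_diff_rdistrib inner_diff_right del: transpose_matrix_vector)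
  show ?thesis
    using assms(3) unfolding loewner_le_def lhs [symmetric] rhs [symmetric] by blast
qed

text \<open>The interface input is built for cancellation: \<open>B Q x'\<close> cancels through the
  identity for \<open>A ** P\<close>, the \<open>L2\<close> terms cancel through the one for
  \<open>E\<close>, and the two internal inputs combine behind the common factor
  \<open>Z\<close>.\<close>

lemma vector_field_error:
  fixes A :: "real^'n^'n" and B :: "real^'m^'n" and Z :: "real^'r^'n" and P :: "real^'nh^'n"
    and x :: "real^'n" and x' :: "real^'nh" and \<phi> :: "real \<Rightarrow> real" and F :: "real^'n^1"
  assumes "D = Z ** W" "A ** P = P ** Ah - B ** Q" "F ** P = Fh"
    and "E = P ** Eh - B ** (L1 - L2)" "P ** Dh = Z ** Wh"
  defines "e \<equiv> x - P *v x'"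
    and "a \<equiv> (\<chi> _. \<phi> ((F *v x) $ 1)) :: real^1" and "a' \<equiv> (\<chi> _. \<phi> ((Fh *v x') $ 1)) :: real^1"
  shows "vector_field A B D E F \<phi> x (K *v e + Q *v x' + L1 *v a - L2 *v a') w
      - P *v vector_field Ah Bh Dh Eh Fh \<phi> x' u' w'
    = (A + B ** K) *v e + Z *v (W *v w - Wh *v w') + (B ** L1 + E) *v (a - a') - P *v (Bh *v u')"
proof -
  have 1: "P *v (Ah *v x') = A *v (P *v x') + B *v (Q *v x')"
    using arg_cong [OF assms(2), of "\<lambda>M. M *v x'"]
    by (simp add: matrix_vector_mul_assoc [symmetric] matrix_vector_mult_diff_rdistrib)
  have 2: "P *v (Eh *v a') = E *v a' + B *v (L1 *v a') - B *v (L2 *v a')"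
    using arg_cong [OF assms(4), of "\<lambda>M. M *v a'"]
    by (simp add: matrix_vector_mul_assoc [symmetric] matrix_vector_mult_diff_rdistrib
        matrix_vector_mult_diff_distrib)
  have 3: "P *v (Dh *v w') = Z *v (Wh *v w')"
    using arg_cong [OF assms(5), of "\<lambda>M. M *v w'"]
    by (simp add: matrix_vector_mul_assoc [symmetric])
  show ?thesis
    unfolding vector_field_def assms(1) a_def [symmetric] a'_def [symmetric]
    by (simp add: 1 2 3 e_def matrix_vector_mul_assoc [symmetric] matrix_vector_mult_diff_distrib
        matrix_vector_right_distrib matrix_vector_mult_add_rdistrib)
qed

theorem theorem5p5:
  fixes A :: "real^'n^'n" and B :: "real^'m^'n" and C1 :: "real^'n^'q1" and C2 :: "real^'n^'q2"
    and D :: "real^'p^'n" and E :: "real^1^'n" and F :: "real^'n^1"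
    and Ah :: "real^'nh^'nh" and Bh :: "real^'mh^'nh" and C1h :: "real^'nh^'q1"
    and C2h :: "real^'nh^'q2h"
    and Dh :: "real^'ph^'nh" and Eh :: "real^1^'nh" and Fh :: "real^'nh^1"
    and \<phi> :: "real \<Rightarrow> real" and b :: ereal and \<kappa> :: real
    and M :: "real^'n^'n" and K :: "real^'n^'m" and L1 :: "real^1^'m" and Z :: "real^'r^'n"
    and W :: "real^'p^'r" and X11 :: "real^'r^'r" and X12 :: "real^'q2^'r"
    and X21 :: "real^'r^'q2" and X22 :: "real^'q2^'q2"
    and P :: "real^'nh^'n" and Q :: "real^'nh^'m" and H :: "real^'q2h^'q2"
    and L2 :: "real^1^'m" and Wh :: "real^'ph^'r"
  assumes "slope_restricted_system b A B D E F \<phi>"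
    and "slope_restricted_system b Ah Bh Dh Eh Fh \<phi>"
    and "\<kappa> > 0"
    and "pos_definite M"
    and "symmetric_matrix ((X11 <|> X12)
                       </> (X21 <|> X22))"
    and "X22 \<preceq> 0"
    and "D = Z ** W"
    and "(  transpose (A + B ** K) ** M + M ** (A + B ** K) <|> M ** Z <|> M ** (B ** L1 + E)
        </> transpose Z ** M                                <|> 0      <|> 0
        </> transpose (B ** L1 + E) ** M                    <|> 0      <|> 0)
       \<preceq>
         (  - (\<kappa> *\<^sub>R M) + transpose C2 ** X22 ** C2 <|> transpose C2 ** X21 <|> - transpose F
        </> X12 ** C2                                <|> X11                <|> 0
        </> - F                                      <|> 0                  <|> mat (real_of_ereal (2 / b)))"
    and "A ** P = P ** Ah - B ** Q"
    and "C1 ** P = C1h"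
    and "X12 ** C2 ** P = X12 ** H ** C2h"
    and "X22 ** C2 ** P = X22 ** H ** C2h"
    and "F ** P = Fh"
    and "E = P ** Eh - B ** (L1 - L2)"
    and "P ** Dh = Z ** Wh"
  shows "storage_function
           (vector_field Ah Bh Dh Eh Fh \<phi>) (\<lambda>x'. C1h *v x') (\<lambda>x'. C2h *v x')
           (vector_field A B D E F \<phi>) (\<lambda>x. C1 *v x) (\<lambda>x. C2 *v x)
           (\<lambda>(x, x'). (x - P *v x') \<bullet> (M *v (x - P *v x')))"
proof -
  let ?V = "\<lambda>(x, x'). (x - P *v x') \<bullet> (M *v (x - P *v x'))"
  let ?X = "(X11 <|> X12) </> (X21 <|> X22)"
  let ?f = "vector_field A B D E F \<phi>" and ?f' = "vector_field Ah Bh Dh Eh Fh \<phi>"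
  have symM: "symmetric_matrix M"
    using assms(4) by (simp add: pos_definite_def)
  have X21: "transpose X12 = X21"
    using assms(5) by (rule symmetric_blockD)
  have b: "slope_restricted b \<phi>" "0 < b"
    using assms(1) by (auto simp: slope_restricted_system_def)
  obtain c where c: "0 < c" "\<And>v. c * (norm v)\<^sup>2 \<le> v \<bullet> (M *v v)"
    using pos_definite_coercive [OF assms(4)] by blast
  obtain k where k: "0 < k" "\<And>e. norm (C1 *v e) \<le> norm e * k"
    using bounded_linear.pos_bounded [OF matrix_vector_mul_bounded_linear] by blast
  obtain l where l: "0 < l" "\<And>u. ((P ** Bh) *v u) \<bullet> (M *v ((P ** Bh) *v u)) \<le> l * (norm u)\<^sup>2"
    using quadratic_form_upper_bound by blast
  define gradV where "gradV z = (let g = 2 *\<^sub>R (M *v (fst z - P *v snd z)) in (g, - (transpose P *v g)))" for z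
  \<comment> \<open>The velocities enter only through \<open>y - P *v y'\<close>, so the derivative
    of \<open>V\<close> needs nothing but the error dynamics.\<close>
  have gradV_inner: "gradV (x, x') \<bullet> (y, y') = 2 * ((x - P *v x') \<bullet> (M *v (y - P *v y')))" for x x' y y'
    using symmetric_matrix_inner [OF symM, of "x - P *v x'" "y - P *v y'"]
    by (simp add: gradV_def Let_def inner_commute [of _ y] inner_commute [of _ y']
        inner_transpose_matrix inner_diff_left inner_commute [of _ "P *v y'"] del: transpose_matrix_vector)
  have grad: "GDERIV ?V z :> gradV z" for z
    unfolding gradV_def by (rule GDERIV_quadratic_error [OF symM])
  have cont: "continuous_on UNIV gradV"
    unfolding gradV_def Let_def
    by (intro continuous_intros bounded_linear.continuous_on [OF matrix_vector_mul_bounded_linear])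
  \<comment> \<open>\<open>storage_function\<close> asks for a natural number of rows:
    \<open>f\<close> enumerates the type \<open>'r\<close>, and \<open>g\<close> extends it by the
    identity on the output indices.\<close>
  obtain f :: "nat \<Rightarrow> 'r" where f: "bij_betw f {..<CARD('r)} UNIV"
    using ex_bij_betw_nat_finite [of "UNIV :: 'r set"] by (auto simp: atLeast0LessThan)
  define g where "g = map_sum f (id :: 'q2 \<Rightarrow> 'q2)"
  have g: "bij_betw g ({..<CARD('r)} <+> UNIV) UNIV"
    unfolding g_def by (rule bij_betw_map_sum_id [OF f])
  have storage_supply: "quad_form ({..<CARD('r)} <+> UNIV) (\<lambda>a b. ?X $ g a $ g b)
        (supply_vector (\<lambda>i. W $ f i) (\<lambda>i. Wh $ f i) w w' y)
      = vjoin (W *v w - Wh *v w') y \<bullet> (?X *v vjoin (W *v w - Wh *v w') y)" for w w' y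
  proof -
    have "supply_vector (\<lambda>i. W $ f i) (\<lambda>i. Wh $ f i) w w' y = (\<lambda>a. vjoin (W *v w - Wh *v w') y $ g a)"
      by (auto simp: fun_eq_iff supply_vector_def vjoin_def g_def matrix_vector_mul_component
          split: sum.split)
    then show ?thesis
      by (simp add: quad_form_reindex [OF g])
  qed
  \<comment> \<open>Since \<open>C1 ** P = C1h\<close>, the output mismatch is
    \<open>C1 *v e\<close> with \<open>e = x - P *v x'\<close>. Its squared norm is at most
    \<open>k\<^sup>2\<close> times that of \<open>e\<close>, and coercivity bounds \<open>c\<close>
    times the latter by \<open>V\<close>.\<close>
  have alpha: "c / k\<^sup>2 * (norm (C1 *v x - C1h *v x'))\<^sup>2 \<le> ?V (x, x')" for x x'
  proof -
    have "C1 *v x - C1h *v x' = C1 *v (x - P *v x')"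
      by (simp add: assms(10) [symmetric] matrix_vector_mult_diff_distrib matrix_vector_mul_assoc)
    then have "(norm (C1 *v x - C1h *v x'))\<^sup>2 \<le> (norm (x - P *v x') * k)\<^sup>2"
      using k by (simp add: power_mono)
    then have "c / k\<^sup>2 * (norm (C1 *v x - C1h *v x'))\<^sup>2 \<le> c / k\<^sup>2 * (norm (x - P *v x') * k)\<^sup>2"
      using c k by (intro mult_left_mono) auto
    also have "\<dots> = c * (norm (x - P *v x'))\<^sup>2"
      using k by (simp add: power_mult_distrib)
    finally show ?thesis
      using c(2) [of "x - P *v x'"] by simp
  qed
  have dissipation: "\<exists>u. \<forall>w' w. gradV (x, x') \<bullet> (?f x u w, ?f' x' u' w')
      \<le> - (\<kappa> / 2 * ?V (x, x')) + 2 / \<kappa> * l * (norm u')\<^sup>2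
        + quad_form ({..<CARD('r)} <+> UNIV) (\<lambda>a b. ?X $ g a $ g b)
            (supply_vector (\<lambda>i. W $ f i) (\<lambda>i. Wh $ f i) w w' (C2 *v x - H *v (C2h *v x')))"
    for x x' u'
  proof -
    define e where "e = x - P *v x'"
    define a a' :: "real^1" where "a = (\<chi> _. \<phi> ((F *v x) $ 1))" and "a' = (\<chi> _. \<phi> ((Fh *v x') $ 1))"
    \<comment> \<open>This input depends on \<open>x\<close> and \<open>x'\<close> only, as the
      quantifier order requires: it is fixed before \<open>w\<close> and \<open>w'\<close>.\<close>
    define u where "u = K *v e + Q *v x' + L1 *v a - L2 *v a'"
    define y where "y = C2 *v x - H *v (C2h *v x')"
    have "gradV (x, x') \<bullet> (?f x u w, ?f' x' u' w')
        \<le> - (\<kappa> / 2 * ?V (x, x')) + 2 / \<kappa> * l * (norm u')\<^sup>2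
          + vjoin (W *v w - Wh *v w') y \<bullet> (?X *v vjoin (W *v w - Wh *v w') y)" for w w'
    proof -
      define \<omega> where "\<omega> = W *v w - Wh *v w'"
      define h where "h = (P ** Bh) *v u'"
      have err: "?f x u w - P *v ?f' x' u' w'
          = (A + B ** K) *v e + Z *v \<omega> + (B ** L1 + E) *v (a - a') - h"
        unfolding u_def a_def a'_def e_def \<omega>_def h_def matrix_vector_mul_assoc [symmetric]
        by (rule vector_field_error) (fact assms)+
      \<comment> \<open>\<open>y\<close> differs from \<open>C2 *v e\<close> by
        \<open>(C2 ** P - H ** C2h) *v x'\<close>, which the hypotheses on \<open>X12\<close> and
        \<open>X22\<close> annihilate. Hence \<open>y\<close> may be replaced only behind these two
        blocks.\<close>
      have y12: "X12 *v y = X12 *v (C2 *v e)"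
        using arg_cong [OF assms(11), of "\<lambda>M. M *v x'"]
        by (simp add: y_def e_def matrix_vector_mult_diff_distrib matrix_vector_mul_assoc [symmetric])
      have y22: "X22 *v y = X22 *v (C2 *v e)"
        using arg_cong [OF assms(12), of "\<lambda>M. M *v x'"]
        by (simp add: y_def e_def matrix_vector_mult_diff_distrib matrix_vector_mul_assoc [symmetric])
      have "symmetric_matrix X22"
        using assms(6) by (simp add: loewner_le_def)
      \<comment> \<open>Symmetry of \<open>X22\<close> brings the left factor \<open>y\<close>
        behind \<open>X22\<close> as well, where it can be replaced.\<close>
      then have "y \<bullet> (X22 *v y) = (C2 *v e) \<bullet> (X22 *v (C2 *v e))"
        using symmetric_matrix_inner [of X22 y "C2 *v e"] by (simp add: y22)
      moreover have "y \<bullet> (X21 *v \<omega>) = \<omega> \<bullet> (X12 *v y)"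
        unfolding X21 [symmetric] by (rule inner_transpose_matrix)
      ultimately have X: "vjoin \<omega> y \<bullet> (?X *v vjoin \<omega> y)
          = \<omega> \<bullet> (X11 *v \<omega>) + 2 * (\<omega> \<bullet> (X12 *v (C2 *v e))) + (C2 *v e) \<bullet> (X22 *v (C2 *v e))"
        by (simp add: vcat_mult hcat_mult_vjoin inner_vjoin inner_add_right y12)
      \<comment> \<open>By \<open>F ** P = Fh\<close>, \<open>F *v e\<close> is the difference of
        the two arguments of \<open>\<phi>\<close>, so the scalar sector bound applies to
        \<open>a - a'\<close>, a vector of dimension one.\<close>
      have "(F *v e) $ 1 = (F *v x) $ 1 - (Fh *v x') $ 1"
        by (simp add: e_def assms(13) [symmetric] matrix_vector_mult_diff_distrib matrix_vector_mul_assoc)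
      then have sector: "real_of_ereal (2 / b) * ((a - a') \<bullet> (a - a')) \<le> 2 * ((a - a') \<bullet> (F *v e))"
        using slope_restricted_sector [OF b, of "(F *v x) $ 1" "(Fh *v x') $ 1"]
        by (simp add: inner_vec_def a_def a'_def power2_eq_square)
      have "- 2 * (e \<bullet> (M *v h)) \<le> \<kappa> / 2 * (e \<bullet> (M *v e)) + 2 / \<kappa> * (h \<bullet> (M *v h))"
        by (rule pos_definite_young [OF assms(4,3)])
      also have "\<dots> \<le> \<kappa> / 2 * (e \<bullet> (M *v e)) + 2 / \<kappa> * (l * (norm u')\<^sup>2)"
        using assms(3) l(2) [of u'] by (intro add_left_mono mult_left_mono) (auto simp: h_def)
      finally have young: "- 2 * (e \<bullet> (M *v h)) \<le> \<kappa> / 2 * (e \<bullet> (M *v e)) + 2 / \<kappa> * (l * (norm u')\<^sup>2)" .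
      have "gradV (x, x') \<bullet> (?f x u w, ?f' x' u' w')
          = 2 * (e \<bullet> (M *v ((A + B ** K) *v e + Z *v \<omega> + (B ** L1 + E) *v (a - a')))) - 2 * (e \<bullet> (M *v h))"
        unfolding gradV_inner err e_def [symmetric]
        by (simp add: matrix_vector_mult_diff_distrib inner_diff_right)
      \<comment> \<open>The sector bound discards the terms in \<open>a - a'\<close> left by the
        matrix inequality. Young's inequality gives back \<open>\<kappa> / 2\<close> of the decay
        \<open>\<kappa>\<close>, so \<open>\<eta>\<close> has slope
        \<open>\<kappa> / 2\<close>.\<close>
      also have "\<dots> \<le> - \<kappa> * (e \<bullet> (M *v e)) + vjoin \<omega> y \<bullet> (?X *v vjoin \<omega> y)
          + \<kappa> / 2 * (e \<bullet> (M *v e)) + 2 / \<kappa> * (l * (norm u')\<^sup>2)"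
        using loewner_block_dissipation [OF symM X21 assms(8), of e \<omega> "a - a'"] sector young X
        by linarith
      finally show ?thesis
        by (simp add: \<omega>_def e_def)
    qed
    then show ?thesis
      unfolding storage_supply y_def by (intro exI [of _ u] allI)
  qed
  show ?thesis
    unfolding storage_function_def
  proof (intro conjI exI)
    show "\<forall>z. 0 \<le> ?V z"
      using pos_definite_nonneg [OF assms(4)] by auto
    show "\<forall>z. GDERIV ?V z :> gradV z"
      using grad by blast
    show "continuous_on UNIV gradV"
      by (rule cont)
    show "class_K_inf (\<lambda>t. c / k\<^sup>2 * t\<^sup>2)"
      using c k by (intro class_K_inf_square) simp
    show "class_K_inf (\<lambda>t. \<kappa> / 2 * t)"
      using assms(3) by (intro class_K_inf_linear) simp
    \<comment> \<open>Positivity of \<open>l\<close> puts \<rho> in the first alternative even when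
      \<open>P ** Bh\<close> is zero.\<close>
    show "class_K_inf (\<lambda>t. 2 / \<kappa> * l * t\<^sup>2) \<or> (\<lambda>t. 2 / \<kappa> * l * t\<^sup>2) = (\<lambda>_. 0)"
      using assms(3) l by (intro disjI1 class_K_inf_square) simp
    show "0 < CARD('r)"
      by simp
    show "\<forall>a\<in>{..<CARD('r)} <+> UNIV. \<forall>b\<in>{..<CARD('r)} <+> UNIV. ?X $ g a $ g b = ?X $ g b $ g a"
      by (intro ballI symmetric_matrix_nth [OF assms(5)])
    \<comment> \<open>On \<open>Inr\<close> indices \<open>g\<close> is the identity, so this block
      is \<open>X22\<close> itself.\<close>
    show "(\<chi> i j. ?X $ g (Inr i) $ g (Inr j)) \<preceq> 0"
      using assms(6) by (simp add: g_def vcat_def hcat_def)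
    show "\<forall>x x'. c / k\<^sup>2 * (norm (C1 *v x - C1h *v x'))\<^sup>2 \<le> ?V (x, x') \<and>
        (\<forall>u'. \<exists>u. \<forall>w' w. gradV (x, x') \<bullet> (?f x u w, ?f' x' u' w')
          \<le> - (\<kappa> / 2 * ?V (x, x')) + 2 / \<kappa> * l * (norm u')\<^sup>2
            + quad_form ({..<CARD('r)} <+> UNIV) (\<lambda>a b. ?X $ g a $ g b)
                (supply_vector (\<lambda>i. W $ f i) (\<lambda>i. Wh $ f i) w w' (C2 *v x - H *v (C2h *v x'))))"
      by (intro allI conjI alpha dissipation)
  qed
qed

end
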